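(* Let $d\ge 2$ be an integer. If a finite simple graph $G$ is the intersection graph of a finite family of homothetic open regular $(d-1)$-simplices in $\mathbb{R}^{d-1}$, then there exists a nonnegative integer $k$ such that the disjoint union of $G$ and $k$ new isolated vertices is (isomorphic to) the competition graph of a $d$-partial order.
   Context: For $\mathbf{x},\mathbf{y}\in\mathbb{R}^d$, write $\mathbf{x}\prec\mathbf{y}$ if $x_i<y_i$ for every $i$. For a finite set $S\subseteq\mathbb{R}^d$, $D_S$ is the digraph with vertex set $S$ and an arc $(\mathbf{x},\mathbf{v})$ whenever $\mathbf{v}\prec\mathbf{x}$. A digraph is a $d$-partial order if it is isomorphic to $D_S$ for some finite $S\subseteq\mathbb{R}^d$. The competition graph of a digraph $D$ has vertex set $V(D)$ and an edge between distinct $x,y$ iff some vertex $z$ has arcs $(x,z),(y,z)$ in $D$. An open regular $(d-1)$-simplex is the interior of a regular $(d-1)$-simplex. Figures are homothetic if one is the image of the other under $\mathbf{x}\mapsto\lambda\mathbf{x}+\mathbf{b}$ with $\lambda>0$. The intersection graph of a family has one vertex per member, two adjacent iff the members intersect. *)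

theory Defs
  imports "HOL-Analysis.Analysis" "Graph_Theory.Graph_Theory"
begin

text \<open>
  Digraphs without parallel arcs are values of type \<^typ>\<open>'a pair_pre_digraph\<close>. A finite simple
  graph is a \<^const>\<open>pair_graph\<close>: finite, loop-free and symmetric, each edge being represented by
  its two opposite arcs. Isomorphism, of graphs and of digraphs alike, is \<^const>\<open>digraph_iso\<close>;
  the following fact unfolds it for this representation.
\<close>

lemma digraph_iso_with_proj_iff:
  "digraph_iso (with_proj G) (with_proj H) \<longleftrightarrow>
     pair_wf_digraph G \<and>
     (\<exists>f. bij_betw f (pverts G) (pverts H) \<and> parcs H = map_prod f f ` parcs G)"
  (is "?L \<longleftrightarrow> ?R")
proof
  assume ?L
  then obtain h where h: "pre_digraph.digraph_isomorphism (with_proj G) h"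
    "with_proj H = app_iso h (with_proj G)"
    by (auto simp: digraph_iso_def)
  from h(1) have w: "wf_digraph (with_proj G)" and i: "inj_on (iso_verts h) (pverts G)"
    and a: "\<And>a. a \<in> parcs G \<Longrightarrow> iso_verts h (fst a) = iso_tail h (iso_arcs h a) \<and>
              iso_verts h (snd a) = iso_head h (iso_arcs h a)"
    by (auto simp: pre_digraph.digraph_isomorphism_def)
  from h(2) have H: "pverts H = iso_verts h ` pverts G" "parcs H = iso_arcs h ` parcs G"
    "iso_tail h = fst" "iso_head h = snd"
    by (auto simp: with_proj_def app_iso_def)
  have "iso_arcs h e = map_prod (iso_verts h) (iso_verts h) e" if "e \<in> parcs G" for e
    using a[OF that] H(3,4) by (simp add: prod_eq_iff)
  then have "parcs H = map_prod (iso_verts h) (iso_verts h) ` parcs G"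
    using H(2) by (metis (no_types, lifting) image_cong)
  moreover have "pair_wf_digraph G"
    using w by (auto simp: wf_digraph_def pair_wf_digraph_def)
  ultimately show ?R using i H(1) by (auto simp: bij_betw_def)
next
  assume ?R
  then obtain f where w: "pair_wf_digraph G" and b: "bij_betw f (pverts G) (pverts H)"
    and p: "parcs H = map_prod f f ` parcs G" by blast
  let ?h = "\<lparr>iso_verts = f, iso_arcs = map_prod f f, iso_head = snd, iso_tail = fst\<rparr>"
  have "wf_digraph (with_proj G)"
    using w by (auto simp: wf_digraph_def pair_wf_digraph_def)
  moreover have "inj_on (map_prod f f) (parcs G)"
    using map_prod_inj_on[of f "pverts G" f "pverts G"] b pair_wf_digraph.wellformed'[OF w]
    by (auto simp: bij_betw_def intro: inj_on_subset)
  ultimately have "pre_digraph.digraph_isomorphism (with_proj G) ?h"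
    using b by (auto simp: pre_digraph.digraph_isomorphism_def bij_betw_def)
  moreover have "with_proj H = app_iso ?h (with_proj G)"
    using b p by (auto simp: with_proj_def app_iso_def bij_betw_def)
  ultimately show ?L by (auto simp: digraph_iso_def)
qed

text \<open>
  The order on points is the library's \<^const>\<open>eucl_less\<close>, strict in every coordinate; it is not
  the strict part \<open><\<close> of the componentwise order \<open>\<le>\<close> on \<^typ>\<open>real^'m\<close>.
\<close>

notation eucl_less (infix "\<prec>" 50)

lemma eucl_less_vec_iff: "x \<prec> y \<longleftrightarrow> (\<forall>i. x $ i < y $ i)" for x y :: "real^'m"
  by (auto simp: eucl_less_def Basis_vec_def inner_axis)

definition dominance_digraph :: "(real^'m) set \<Rightarrow> (real^'m) pair_pre_digraph" where
  "dominance_digraph S = \<lparr>pverts = S, parcs = {(x, v). x \<in> S \<and> v \<in> S \<and> v \<prec> x}\<rparr>"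

text \<open>The type argument \<open>'m\<close> carries the dimension \<open>d = CARD('m)\<close>.\<close>

definition d_partial_order :: "'m::finite itself \<Rightarrow> 'a pair_pre_digraph \<Rightarrow> bool" where
  "d_partial_order M D \<longleftrightarrow>
     (\<exists>S :: (real^'m) set. finite S \<and> digraph_iso (with_proj D) (with_proj (dominance_digraph S)))"

definition competition_graph :: "'a pair_pre_digraph \<Rightarrow> 'a pair_pre_digraph" where
  "competition_graph D = \<lparr>pverts = pverts D,
     parcs = {(x, y). x \<in> pverts D \<and> y \<in> pverts D \<and> x \<noteq> y \<and>
                (\<exists>z \<in> pverts D. (x, z) \<in> parcs D \<and> (y, z) \<in> parcs D)}\<rparr>"

text \<open>A family is indexed, so equal members at different indices give different vertices.\<close>

definition intersection_graph :: "'i set \<Rightarrow> ('i \<Rightarrow> 'b set) \<Rightarrow> 'i pair_pre_digraph" where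
  "intersection_graph I F = \<lparr>pverts = I,
     parcs = {(i, j). i \<in> I \<and> j \<in> I \<and> i \<noteq> j \<and> F i \<inter> F j \<noteq> {}}\<rparr>"

definition add_isolated :: "'a pair_pre_digraph \<Rightarrow> nat \<Rightarrow> ('a + nat) pair_pre_digraph" where
  "add_isolated G k = \<lparr>pverts = pverts G <+> {..<k}, parcs = map_prod Inl Inl ` parcs G\<rparr>"

text \<open>
  The library's \<^term>\<open>n simplex T\<close> together with the requirement that all edges have the same
  length.
\<close>

definition regular_simplex :: "int \<Rightarrow> 'b::euclidean_space set \<Rightarrow> bool" where
  "regular_simplex n T \<longleftrightarrow>
     (\<exists>C. \<not> affine_dependent C \<and> int (card C) = n + 1 \<and> T = convex hull C \<and>
        (\<exists>l. \<forall>x\<in>C. \<forall>y\<in>C. x \<noteq> y \<longrightarrow> dist x y = l))"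

lemma regular_simplex_imp_simplex: "regular_simplex n T \<Longrightarrow> n simplex T"
  by (auto simp: regular_simplex_def simplex_def)

text \<open>Full-dimensional in the ambient space, so that the interior is nonempty.\<close>

definition open_regular_simplex :: "'b::euclidean_space set \<Rightarrow> bool" where
  "open_regular_simplex U \<longleftrightarrow> (\<exists>T. regular_simplex (int DIM('b)) T \<and> U = interior T)"

definition homothetic :: "'b::real_vector set \<Rightarrow> 'b set \<Rightarrow> bool" where
  "homothetic A B \<longleftrightarrow> (\<exists>c b. c > 0 \<and> B = (\<lambda>x. c *\<^sub>R x + b) ` A)"

end

theory Submission
  imports Defs
begin

text \<open>
  In barycentric coordinates with respect to the vertices of one simplex, negated, the points of
  \<open>\<real>\<^sup>d\<^sup>-\<^sup>1\<close> become the points \<open>w\<close> of a hyperplane of constant coordinate sum in \<open>\<real>\<^sup>d\<close>, and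
  each open homothet of the simplex becomes \<open>{w. w \<prec> p}\<close> for some point \<open>p\<close> strictly above that
  hyperplane. Hence two homothets meet iff some \<open>w\<close> in the hyperplane lies below both apexes. Take as
  vertices the apexes, lowered slightly to make them distinct, and one witness \<open>w\<close> for each
  intersecting pair. Witnesses dominate nothing, because no vertex has a smaller coordinate sum, so
  they are isolated; and an apex below two others itself dominates a witness, so it creates no
  spurious edge.
\<close>

no_notation lesspoll (infixl "\<prec>" 50)

section \<open>Strict coordinatewise order and the choice of distinct points\<close>

lemma eucl_less_vec_trans: "x \<prec> y \<Longrightarrow> y \<prec> z \<Longrightarrow> x \<prec> z" for x y z :: "real^'m"
  by (meson eucl_less_vec_iff less_trans)

lemma sum_less_of_eucl_less: "x \<prec> y \<Longrightarrow> (\<Sum>k\<in>UNIV. x $ k) < (\<Sum>k\<in>UNIV. y $ k)"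
  for x y :: "real^'m"
  by (intro sum_strict_mono) (auto simp: eucl_less_vec_iff)

text \<open>The open box from the coordinatewise maximum of \<open>A\<close> to \<open>p\<close> is
  nonempty, hence infinite. This is the room for lowering an apex without losing the witnesses below
  it.\<close>

lemma infinite_between:
  fixes p :: "real^'m"
  assumes "finite A" "\<And>w. w \<in> A \<Longrightarrow> w \<prec> p"
  shows "infinite {q. q \<prec> p \<and> (\<forall>w\<in>A. w \<prec> q)}"
proof -
  \<comment> \<open>The extra point \<open>p - 1\<close> makes the set nonempty, so that
    \<open>Max\<close> is meaningful even for empty \<open>A\<close>.\<close>
  define B where "B = insert (p - 1) A"
  have B: "finite B" "B \<noteq> {}" "\<And>w. w \<in> B \<Longrightarrow> w \<prec> p"
    using assms by (auto simp: B_def eucl_less_vec_iff)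
  define a where "a = (\<chi> k. Max ((\<lambda>w. w $ k) ` B))"
  have "a \<prec> p" using B by (auto simp: a_def eucl_less_vec_iff)
  then have "box a p \<noteq> {}"
    by (auto simp: box_ne_empty eucl_less_def)
  then have "infinite (box a p)"
    using finite_imp_not_open open_box by blast
  moreover have "w \<prec> q" if "w \<in> A" "a \<prec> q" for w q
    unfolding eucl_less_vec_iff
  proof
    fix k
    have "w $ k \<le> a $ k" using that B by (auto simp: a_def B_def)
    also have "\<dots> < q $ k" using that by (auto simp: eucl_less_vec_iff)
    finally show "w $ k < q $ k" .
  qed
  then have "box a p \<subseteq> {q. q \<prec> p \<and> (\<forall>w\<in>A. w \<prec> q)}"
    by (auto simp: box_eucl_less)
  ultimately show ?thesis using finite_subset by blast
qed

text \<open>Greedy choice: only finitely many values are taken at each stage. It keeps the vertices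
  of different indices apart even when their apexes coincide.\<close>

lemma injective_choice:
  assumes "finite I" "\<And>i. i \<in> I \<Longrightarrow> infinite (A i)"
  shows "\<exists>q. inj_on q I \<and> (\<forall>i\<in>I. q i \<in> A i)"
  using assms
proof (induction I rule: finite_induct)
  case (insert i I)
  then obtain q where q: "inj_on q I" "\<forall>j\<in>I. q j \<in> A j" by auto
  have "infinite (A i - q ` I)" using insert by (simp add: Diff_infinite_finite)
  then obtain a where a: "a \<in> A i" "a \<notin> q ` I"
    by (metis DiffE finite.emptyI ex_in_conv)
  have "inj_on (q(i := a)) (insert i I)"
    using q a insert.hyps by (auto simp: inj_on_def)
  moreover have "\<forall>j\<in>insert i I. (q(i := a)) j \<in> A j" using q a by auto
  ultimately show ?case by blast
qed auto

section \<open>From apexes to a competition graph\<close>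

lemma competition_graph_dominance_digraph:
  "competition_graph (dominance_digraph S) =
     \<lparr>pverts = S, parcs = {(x, y). x \<in> S \<and> y \<in> S \<and> x \<noteq> y \<and> (\<exists>z\<in>S. z \<prec> x \<and> z \<prec> y)}\<rparr>"
  by (auto simp: competition_graph_def dominance_digraph_def)

text \<open>\<open>M i j\<close> holds the candidate witnesses for the pair \<open>i\<close>,
  \<open>j\<close>, all with coordinate sum \<open>s\<close>. The points \<open>q i\<close> are the
  lowered apexes and \<open>W\<close> is the set of chosen witnesses.\<close>

lemma ex_dominance_competition_graph:
  fixes p :: "'i \<Rightarrow> real^'m" and s :: real
  defines "M \<equiv> \<lambda>i j. {w. (\<Sum>k\<in>UNIV. w $ k) = s \<and> w \<prec> p i \<and> w \<prec> p j}"
  assumes "finite I" and ne: "\<forall>i\<in>I. M i i \<noteq> {}"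
  shows "\<exists>(q :: 'i \<Rightarrow> real^'m) W. inj_on q I \<and> finite W \<and> q ` I \<inter> W = {} \<and>
           competition_graph (dominance_digraph (q ` I \<union> W)) =
             \<lparr>pverts = q ` I \<union> W,
              parcs = map_prod q q ` {(i, j). i \<in> I \<and> j \<in> I \<and> i \<noteq> j \<and> M i j \<noteq> {}}\<rparr>"
proof -
  \<comment> \<open>The diagonal pairs are kept: they give every apex a witness of its own.\<close>
  define E where "E = {(i, j). i \<in> I \<and> j \<in> I \<and> M i j \<noteq> {}}"
  define w where "w i j = (SOME w. w \<in> M i j)" for i j
  define W where "W = case_prod w ` E"
  have "finite E"
    by (rule finite_subset[of _ "I \<times> I"]) (use assms in \<open>auto simp: E_def\<close>)
  then have finW: "finite W" by (simp add: W_def)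
  have wM: "w i j \<in> M i j" if "(i, j) \<in> E" for i j
    using that some_in_eq unfolding w_def E_def by auto
  have Wsum: "(\<Sum>k\<in>UNIV. z $ k) = s" if "z \<in> W" for z
    using that wM by (auto simp: W_def M_def)
  \<comment> \<open>Lowering must preserve only the finitely many witnesses already below
    \<open>p i\<close>.\<close>
  have "infinite {q. q \<prec> p i \<and> (\<forall>z\<in>{z\<in>W. z \<prec> p i}. z \<prec> q)}" for i
    by (rule infinite_between) (use finW in auto)
  then obtain q where q: "inj_on q I"
    and qp: "\<And>i. i \<in> I \<Longrightarrow> q i \<prec> p i"
    and Wq: "\<And>i z. i \<in> I \<Longrightarrow> z \<in> W \<Longrightarrow> z \<prec> p i \<Longrightarrow> z \<prec> q i"
    using injective_choice[OF \<open>finite I\<close>, of "\<lambda>i. {q. q \<prec> p i \<and> (\<forall>z\<in>{z\<in>W. z \<prec> p i}. z \<prec> q)}"]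
    by auto
  have wW: "w i j \<in> W" and wq: "w i j \<prec> q i" "w i j \<prec> q j" if "(i, j) \<in> E" for i j
  proof -
    show "w i j \<in> W" using that by (force simp: W_def)
    then show "w i j \<prec> q i" "w i j \<prec> q j"
      using that wM[OF that] Wq by (auto simp: M_def E_def)
  qed
  have refl: "(i, i) \<in> E" if "i \<in> I" for i using that ne by (auto simp: E_def)
  \<comment> \<open>By transitivity, any common lower neighbour can therefore be replaced by a
    witness.\<close>
  have below: "\<exists>u\<in>W. u = z \<or> u \<prec> z" if "z \<in> q ` I \<union> W" for z
    using that wW refl wq by blast
  \<comment> \<open>Otherwise one witness would lie strictly below another, although both have
    coordinate sum \<open>s\<close>.\<close>
  have minimal: "\<not> z \<prec> u" if u: "u \<in> W" and z: "z \<in> q ` I \<union> W" for u z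
  proof
    assume "z \<prec> u"
    then obtain v where "v \<in> W" "v \<prec> u" using below[OF z] eucl_less_vec_trans by blast
    then show False using sum_less_of_eucl_less[of v u] Wsum u by simp
  qed
  have disj: "q ` I \<inter> W = {}"
  proof (intro equals0I, elim IntE imageE)
    fix u i assume "u \<in> W" "u = q i" "i \<in> I"
    then show False using minimal[of u "w i i"] wq(1)[OF refl] wW[OF refl] by simp
  qed
  have arc: "(\<exists>z\<in>q ` I \<union> W. z \<prec> q i \<and> z \<prec> q j) \<longleftrightarrow> M i j \<noteq> {}" if ij: "i \<in> I" "j \<in> I" for i j
  proof
    assume "\<exists>z\<in>q ` I \<union> W. z \<prec> q i \<and> z \<prec> q j"
    then obtain u where "u \<in> W" "u \<prec> q i" "u \<prec> q j"
      using below eucl_less_vec_trans by metis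
    then have "u \<in> M i j"
      using Wsum qp ij eucl_less_vec_trans by (auto simp: M_def) blast+
    then show "M i j \<noteq> {}" by blast
  next
    assume "M i j \<noteq> {}"
    then have "(i, j) \<in> E" using ij by (simp add: E_def)
    then show "\<exists>z\<in>q ` I \<union> W. z \<prec> q i \<and> z \<prec> q j" using wW wq by blast
  qed
  have "{(x, y). x \<in> q ` I \<union> W \<and> y \<in> q ` I \<union> W \<and> x \<noteq> y \<and> (\<exists>z\<in>q ` I \<union> W. z \<prec> x \<and> z \<prec> y)} =
      map_prod q q ` {(i, j). i \<in> I \<and> j \<in> I \<and> i \<noteq> j \<and> M i j \<noteq> {}}" (is "?L = ?R")
  proof (intro subset_antisym subsetI)
    fix e assume "e \<in> ?L"
    then obtain x y where e: "e = (x, y)" "x \<in> q ` I \<union> W" "y \<in> q ` I \<union> W" "x \<noteq> y"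
      "\<exists>z\<in>q ` I \<union> W. z \<prec> x \<and> z \<prec> y" by blast
    \<comment> \<open>A vertex with something below it is no witness, so both ends of an edge are
      lowered apexes.\<close>
    then have "x \<in> q ` I" "y \<in> q ` I" using minimal by blast+
    then obtain i j where ij: "i \<in> I" "j \<in> I" "x = q i" "y = q j" by blast
    then have "M i j \<noteq> {}" using arc e(5) by blast
    then show "e \<in> ?R" using e ij by force
  next
    fix e assume "e \<in> ?R"
    then obtain i j where ij: "e = (q i, q j)" "i \<in> I" "j \<in> I" "i \<noteq> j" "M i j \<noteq> {}" by auto
    have "q i \<noteq> q j" using q ij by (auto dest: inj_onD)
    then show "e \<in> ?L" using ij arc[OF ij(2,3)] by auto
  qed
  then have "competition_graph (dominance_digraph (q ` I \<union> W)) =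
      \<lparr>pverts = q ` I \<union> W,
       parcs = map_prod q q ` {(i, j). i \<in> I \<and> j \<in> I \<and> i \<noteq> j \<and> M i j \<noteq> {}}\<rparr>"
    by (simp only: competition_graph_dominance_digraph)
  with q finW disj show ?thesis by blast
qed

section \<open>Barycentric coordinates and homothets\<close>

text \<open>The difference of two coordinate vectors with the same sum and the same image would be
  an affine dependence of \<open>C\<close> unless it vanishes.\<close>

lemma barycentric_inj:
  fixes g :: "'m::finite \<Rightarrow> 'b::euclidean_space"
  assumes C: "\<not> affine_dependent C" and g: "bij_betw g UNIV C"
  shows "inj_on (\<lambda>w :: real^'m. - (\<Sum>k\<in>UNIV. w $ k *\<^sub>R g k)) {w. (\<Sum>k\<in>UNIV. w $ k) = s}"
proof (rule inj_onI, unfold mem_Collect_eq)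
  fix w w' :: "real^'m"
  assume s: "(\<Sum>k\<in>UNIV. w $ k) = s" "(\<Sum>k\<in>UNIV. w' $ k) = s"
    and eq: "- (\<Sum>k\<in>UNIV. w $ k *\<^sub>R g k) = - (\<Sum>k\<in>UNIV. w' $ k *\<^sub>R g k)"
  have inj: "inj g" and Cg: "C = range g" using g by (auto simp: bij_betw_def)
  define U where "U v = w $ inv g v - w' $ inv g v" for v
  have "sum U C = 0"
    using s inj by (simp add: Cg sum.reindex U_def sum_subtractf)
  moreover have "(\<Sum>v\<in>C. U v *\<^sub>R v) = 0"
    using eq inj by (simp add: Cg sum.reindex U_def sum_subtractf scaleR_diff_left)
  ultimately have "\<forall>v\<in>C. U v = 0"
    using C affine_dependent_explicit_finite[of C] Cg by auto
  then show "w = w'" using inj by (auto simp: Cg U_def vec_eq_iff)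
qed

text \<open>Affinely independent points, one more than the dimension, have the whole space as affine
  hull.\<close>

lemma ex_barycentric:
  fixes g :: "'m::finite \<Rightarrow> 'b::euclidean_space"
  assumes C: "\<not> affine_dependent C" "card C = Suc DIM('b)" and g: "bij_betw g UNIV C"
  shows "\<exists>t :: real^'m. (\<Sum>k\<in>UNIV. t $ k) = 1 \<and> (\<Sum>k\<in>UNIV. t $ k *\<^sub>R g k) = x"
proof -
  have inj: "inj g" and Cg: "C = range g" using g by (auto simp: bij_betw_def)
  have "x \<in> affine hull C" using affine_independent_span_eq[OF C] by simp
  then obtain u where "sum u C = 1" "(\<Sum>v\<in>C. u v *\<^sub>R v) = x"
    using affine_hull_finite[of C] Cg by auto
  then show ?thesis
    using inj by (intro exI[of _ "\<chi> k. u (g k)"]) (simp add: Cg sum.reindex)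
qed

text \<open>Interior points are exactly those with positive barycentric coordinates
  \<open>u\<close>. Scaling and translating turns \<open>u\<close> into \<open>c * u - p\<close> for
  a fixed \<open>p\<close>; after negation, positivity of \<open>u\<close> reads
  \<open>w \<prec> p\<close>.\<close>

lemma homothet_open_simplex_barycentric:
  fixes g :: "'m::finite \<Rightarrow> 'b::euclidean_space"
  assumes C: "\<not> affine_dependent C" "card C = Suc DIM('b)" and g: "bij_betw g UNIV C"
    and "c > 0"
  shows "\<exists>p :: real^'m. (\<lambda>x. c *\<^sub>R x + b) ` interior (convex hull C) =
     (\<lambda>w. - (\<Sum>k\<in>UNIV. w $ k *\<^sub>R g k)) ` {w. (\<Sum>k\<in>UNIV. w $ k) = -1 \<and> w \<prec> p}"
proof -
  have inj: "inj g" and Cg: "C = range g" using g by (auto simp: bij_betw_def)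
  obtain \<beta> :: "real^'m" where \<beta>: "(\<Sum>k\<in>UNIV. \<beta> $ k) = 1" "(\<Sum>k\<in>UNIV. \<beta> $ k *\<^sub>R g k) = b"
    using ex_barycentric[OF C g] by blast
  obtain \<zeta> :: "real^'m" where \<zeta>: "(\<Sum>k\<in>UNIV. \<zeta> $ k) = 1" "(\<Sum>k\<in>UNIV. \<zeta> $ k *\<^sub>R g k) = 0"
    using ex_barycentric[OF C g] by blast
  \<comment> \<open>\<beta> represents \<open>b\<close> and \<zeta> the origin. The term in \<zeta>
    changes no point but corrects the coordinate sum: \<open>p\<close> has sum \<open>c - 1\<close>,
    so subtracting \<open>c * u\<close> gives -1.\<close>
  define p where "p = c *\<^sub>R \<zeta> - \<beta>"
  have interior: "interior (convex hull C) =
      {y. \<exists>u. (\<forall>v\<in>C. 0 < u v) \<and> sum u C = 1 \<and> (\<Sum>v\<in>C. u v *\<^sub>R v) = y}"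
    using interior_convex_hull_explicit_minimal[OF C(1)] C(2) by simp
  have "(\<lambda>x. c *\<^sub>R x + b) ` interior (convex hull C) =
     (\<lambda>w. - (\<Sum>k\<in>UNIV. w $ k *\<^sub>R g k)) ` {w. (\<Sum>k\<in>UNIV. w $ k) = -1 \<and> w \<prec> p}"
    (is "?L = ?\<Phi> ` ?R")
  proof (intro subset_antisym subsetI)
    fix y assume "y \<in> ?L"
    then obtain u where u: "\<forall>v\<in>C. 0 < u v" "sum u C = 1" "y = c *\<^sub>R (\<Sum>v\<in>C. u v *\<^sub>R v) + b"
      by (auto simp: interior)
    define w where "w = p - (\<chi> k. c * u (g k))"
    have "(\<Sum>k\<in>UNIV. u (g k)) = 1" using u inj by (simp add: Cg sum.reindex)
    then have "(\<Sum>k\<in>UNIV. w $ k) = -1"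
      using \<beta> \<zeta> by (simp add: w_def p_def sum_subtractf flip: sum_distrib_left)
    moreover have "w \<prec> p"
      using u \<open>c > 0\<close> by (auto simp: w_def eucl_less_vec_iff Cg)
    moreover have "?\<Phi> w = y"
      using \<beta> \<zeta> u inj
      by (simp add: w_def p_def sum_subtractf scaleR_diff_left Cg sum.reindex
               flip: scaleR_scaleR scaleR_sum_right)
    ultimately show "y \<in> ?\<Phi> ` ?R" by blast
  next
    fix y assume "y \<in> ?\<Phi> ` ?R"
    then obtain w where w: "(\<Sum>k\<in>UNIV. w $ k) = -1" "w \<prec> p" "y = ?\<Phi> w" by blast
    define u where "u v = (p - w) $ inv g v / c" for v
    have "\<forall>v\<in>C. 0 < u v"
      using w \<open>c > 0\<close> inj by (auto simp: u_def Cg eucl_less_vec_iff)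
    moreover have "sum u C = 1"
      using w \<beta> \<zeta> \<open>c > 0\<close> inj
      by (simp add: u_def Cg sum.reindex p_def sum_subtractf flip: sum_distrib_left sum_divide_distrib)
    moreover have "c *\<^sub>R (\<Sum>v\<in>C. u v *\<^sub>R v) + b = y"
      using w \<beta> \<zeta> \<open>c > 0\<close> inj
      by (simp add: u_def Cg sum.reindex p_def scaleR_sum_right)
         (simp add: sum_subtractf scaleR_diff_left flip: scaleR_scaleR scaleR_sum_right)
    ultimately show "y \<in> ?L" unfolding interior by blast
  qed
  then show ?thesis by blast
qed

text \<open>All members are homothets of one simplex, so a single coordinate map serves them all. It
  is injective on the hyperplane, hence commutes with intersections.\<close>

lemma homothetic_open_simplices_apexes:
  fixes F :: "'i \<Rightarrow> 'b::euclidean_space set"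
  assumes card: "CARD('m::finite) = Suc DIM('b)"
    and simplex: "\<And>i. i \<in> I \<Longrightarrow> open_regular_simplex (F i)"
    and homothetic: "\<And>i j. i \<in> I \<Longrightarrow> j \<in> I \<Longrightarrow> homothetic (F i) (F j)"
  shows "\<exists>p :: 'i \<Rightarrow> real^'m. \<forall>i\<in>I. \<forall>j\<in>I.
    F i \<inter> F j \<noteq> {} \<longleftrightarrow> {w. (\<Sum>k\<in>UNIV. w $ k) = -1 \<and> w \<prec> p i \<and> w \<prec> p j} \<noteq> {}"
proof (cases "I = {}")
  case False
  then obtain i\<^sub>0 where i\<^sub>0: "i\<^sub>0 \<in> I" by blast
  then obtain C where C: "\<not> affine_dependent C" "int (card C) = int DIM('b) + 1"
    "F i\<^sub>0 = interior (convex hull C)"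
    using simplex[OF i\<^sub>0] unfolding open_regular_simplex_def regular_simplex_def by blast
  then have cardC: "card C = Suc DIM('b)" by simp
  obtain g :: "'m \<Rightarrow> 'b" where g: "bij_betw g UNIV C"
    using finite_same_card_bij[of "UNIV :: 'm set" C] C(1) cardC card
    by (auto simp: aff_independent_finite)
  define \<Phi> where "\<Phi> = (\<lambda>w :: real^'m. - (\<Sum>k\<in>UNIV. w $ k *\<^sub>R g k))"
  define H where "H = {w :: real^'m. (\<Sum>k\<in>UNIV. w $ k) = -1}"
  have inj: "inj_on \<Phi> H"
    using barycentric_inj[OF C(1) g] by (simp add: \<Phi>_def H_def)
  have "\<exists>p. F i = \<Phi> ` {w\<in>H. w \<prec> p}" if i: "i \<in> I" for i
  proof -
    obtain c b where "c > 0" "F i = (\<lambda>x. c *\<^sub>R x + b) ` interior (convex hull C)"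
      using homothetic[OF i\<^sub>0 i] C(3) by (auto simp: homothetic_def)
    then show ?thesis
      using homothet_open_simplex_barycentric[OF C(1) cardC g, of c b] by (simp add: \<Phi>_def H_def)
  qed
  then obtain p where p: "\<And>i. i \<in> I \<Longrightarrow> F i = \<Phi> ` {w\<in>H. w \<prec> p i}" by metis
  have "F i \<inter> F j = \<Phi> ` {w\<in>H. w \<prec> p i \<and> w \<prec> p j}" if "i \<in> I" "j \<in> I" for i j
  proof -
    have "F i \<inter> F j = \<Phi> ` ({w\<in>H. w \<prec> p i} \<inter> {w\<in>H. w \<prec> p j})"
      unfolding p[OF that(1)] p[OF that(2)]
      by (rule inj_on_image_Int[OF inj, symmetric]) auto
    also have "{w\<in>H. w \<prec> p i} \<inter> {w\<in>H. w \<prec> p j} = {w\<in>H. w \<prec> p i \<and> w \<prec> p j}" by blast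
    finally show ?thesis .
  qed
  then show ?thesis by (intro exI[of _ p]) (simp add: H_def)
qed simp

text \<open>In full dimension the interior is the relative interior, which is nonempty for a
  nonempty convex set.\<close>

lemma open_regular_simplex_nonempty:
  assumes "open_regular_simplex (U :: 'b::euclidean_space set)"
  shows "U \<noteq> {}"
proof -
  obtain C where C: "\<not> affine_dependent C" "int (card C) = int DIM('b) + 1"
    "U = interior (convex hull C)"
    using assms unfolding open_regular_simplex_def regular_simplex_def by blast
  have "aff_dim C = int DIM('b)"
    using aff_dim_affine_independent[OF C(1)] C(2) by simp
  then have "rel_interior (convex hull C) = U"
    using C(3) by (simp add: rel_interior_interior affine_hull_convex_hull flip: aff_dim_eq_full)
  moreover have "C \<noteq> {}" using C(2) by auto
  ultimately show ?thesis using rel_interior_eq_empty[of "convex hull C"] by auto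
qed

section \<open>Assembling the isomorphism\<close>

theorem theorem2p10:
  fixes d :: nat
    and G :: "'v pair_pre_digraph"
    and I :: "'i set"
    and F :: "'i \<Rightarrow> (real^'n) set"
  assumes "d \<ge> 2"
    and "CARD('m::finite) = d"
    and "CARD('n) = d - 1"
    and "pair_graph G"
    and "finite I"
    and "\<And>i. i \<in> I \<Longrightarrow> open_regular_simplex (F i)"
    and "\<And>i j. i \<in> I \<Longrightarrow> j \<in> I \<Longrightarrow> homothetic (F i) (F j)"
    and "digraph_iso (with_proj G) (with_proj (intersection_graph I F))"
  shows "\<exists>(k::nat) (D :: (real^'m) pair_pre_digraph).
           d_partial_order TYPE('m) D \<and>
           digraph_iso (with_proj (add_isolated G k)) (with_proj (competition_graph D))"
proof -
  have "CARD('m) = Suc DIM(real^'n)" using assms(1-3) by simp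
  then have "\<exists>p :: 'i \<Rightarrow> real^'m. \<forall>i\<in>I. \<forall>j\<in>I.
      F i \<inter> F j \<noteq> {} \<longleftrightarrow> {w. (\<Sum>k\<in>UNIV. w $ k) = -1 \<and> w \<prec> p i \<and> w \<prec> p j} \<noteq> {}"
    by (rule homothetic_open_simplices_apexes) (use assms(6,7) in auto)
  then obtain p :: "'i \<Rightarrow> real^'m" where p: "\<And>i j. i \<in> I \<Longrightarrow> j \<in> I \<Longrightarrow>
      F i \<inter> F j \<noteq> {} \<longleftrightarrow> {w. (\<Sum>k\<in>UNIV. w $ k) = -1 \<and> w \<prec> p i \<and> w \<prec> p j} \<noteq> {}"
    by blast
  \<comment> \<open>The case \<open>j = i\<close>: a nonempty member meets itself, so its apex has a
    witness.\<close>
  have "\<forall>i\<in>I. {w. (\<Sum>k\<in>UNIV. w $ k) = -1 \<and> w \<prec> p i \<and> w \<prec> p i} \<noteq> {}"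
    using p open_regular_simplex_nonempty[OF assms(6)] by blast
  from ex_dominance_competition_graph[where p = p and s = "-1", OF \<open>finite I\<close> this]
  obtain q :: "'i \<Rightarrow> real^'m" and W where q: "inj_on q I" "finite W" "q ` I \<inter> W = {}"
    and cg0: "competition_graph (dominance_digraph (q ` I \<union> W)) =
      \<lparr>pverts = q ` I \<union> W, parcs = map_prod q q ` {(i, j). i \<in> I \<and> j \<in> I \<and> i \<noteq> j \<and>
         {w. (\<Sum>k\<in>UNIV. w $ k) = -1 \<and> w \<prec> p i \<and> w \<prec> p j} \<noteq> {}}\<rparr>"
    by blast
  have "{(i, j). i \<in> I \<and> j \<in> I \<and> i \<noteq> j \<and>
      {w. (\<Sum>k\<in>UNIV. w $ k) = -1 \<and> w \<prec> p i \<and> w \<prec> p j} \<noteq> {}} = parcs (intersection_graph I F)"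
    using p by (auto simp: intersection_graph_def)
  with cg0 have cg: "competition_graph (dominance_digraph (q ` I \<union> W)) =
      \<lparr>pverts = q ` I \<union> W, parcs = map_prod q q ` parcs (intersection_graph I F)\<rparr>"
    by simp
  define D where "D = dominance_digraph (q ` I \<union> W)"
  have wfD: "pair_wf_digraph D"
    by (auto simp: pair_wf_digraph_def D_def dominance_digraph_def)
  have "digraph_iso (with_proj D) (with_proj D)"
    unfolding digraph_iso_with_proj_iff
    using wfD by (intro conjI exI[of _ id]) (auto simp: map_prod.id)
  then have dpo: "d_partial_order TYPE('m) D"
    unfolding d_partial_order_def using q(2) \<open>finite I\<close>
    by (intro exI[of _ "q ` I \<union> W"]) (simp add: D_def)
  from assms(8) obtain f where wfG: "pair_wf_digraph G" and f: "bij_betw f (pverts G) I"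
    and fG: "parcs (intersection_graph I F) = map_prod f f ` parcs G"
    by (auto simp: digraph_iso_with_proj_iff intersection_graph_def)
  \<comment> \<open>The witnesses play the role of the new isolated vertices, so \<open>k\<close> is
    \<open>card W\<close>.\<close>
  obtain e where e: "bij_betw e {..<card W} W"
    using ex_bij_betw_nat_finite[OF q(2)] by (auto simp: atLeast0LessThan)
  \<comment> \<open>Vertices of \<open>G\<close> go to lowered apexes through their indices, new
    vertices to witnesses.\<close>
  define h where "h = case_sum (q \<circ> f) e"
  have "bij_betw (q \<circ> f) (pverts G) (q ` I)"
    using bij_betw_trans[OF f inj_on_imp_bij_betw[OF q(1)]] .
  then have "bij_betw h (Inl ` pverts G) (q ` I)"
    by (simp add: h_def bij_betw_def inj_on_def image_image)
  moreover have "bij_betw h (Inr ` {..<card W}) W"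
    using e by (simp add: h_def bij_betw_def inj_on_def image_image)
  ultimately have "bij_betw h (pverts G <+> {..<card W}) (q ` I \<union> W)"
    unfolding Plus_def using q(3) by (rule bij_betw_combine)
  moreover have "map_prod q q ` parcs (intersection_graph I F) =
      map_prod h h ` map_prod Inl Inl ` parcs G"
    by (auto simp: fG h_def image_image prod.map_comp o_def)
  moreover have "pair_wf_digraph (add_isolated G (card W))"
    using pair_wf_digraph.wellformed'[OF wfG]
    by (force simp: pair_wf_digraph_def add_isolated_def)
  ultimately have "digraph_iso (with_proj (add_isolated G (card W)))
      (with_proj (competition_graph D))"
    unfolding digraph_iso_with_proj_iff D_def cg
    by (auto simp: add_isolated_def)
  with dpo show ?thesis by blast
qed

end
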